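(* Let $(X,\le)$ be a quasi-ordered set, let $D=(d_i;\, i\ge 0)$ be a sufficient denumerable family of semimetrics on $X$, and assume that $(X;\le;D)$ is strongly complete. Let $\Phi=(\varphi_i;\, i\ge 0)$ be a sequence of functions $\varphi_i:X\to\mathbb{R}\cup\{\infty\}$ such that: - $\Phi$ is proper: $\mathrm{Dom}(\Phi):=\bigcap_{i\ge 0}\mathrm{Dom}(\varphi_i)\neq\emptyset$; - for some $j\in\{3,4\}$, all $\varphi_i$ ($i\ge 0$) belong to the subclass (P$j$); - for some $k\in\{1,2,3\}$, all $\varphi_i$ ($i\ge 0$) belong to the subclass (L$k$). Then, for each $u\in\mathrm{Dom}(\Phi)$ there exists $v\in\mathrm{Dom}(\Phi)$ such that $$u\le v\quad\text{and}\quad d_i(u,v)\le\varphi_i(u)-\varphi_i(v)\quad\text{for all } i\ge 0,$$ and, for every $x\in X$ with $v\le x$ and $x\ne v$, there exists an index $i=i(x)\ge 0$ with $$d_i(v,x)>\varphi_i(v)-\varphi_i(x).$$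
   Context: A quasi-order is a reflexive and transitive relation. A semimetric on $X$ is a map $d:X\times X\to[0,\infty)$ that is symmetric, satisfies the triangle inequality, and has $d(x,x)=0$ for all $x$. The family $D=(d_i;\,i\ge0)$ is sufficient if $d_i(x,y)=0$ for all $i\ge 0$ implies $x=y$. A sequence $(x_n)$ in $X$ $D$-converges to $x$ (written $x_n\to_D x$; $x$ is the $D$-limit) if $d_i(x_n,x)\to0$ as $n\to\infty$ for each $i\ge0$; it is $D$-Cauchy if $d_i(x_m,x_n)\to0$ as $m,n\to\infty$ for each $i\ge 0$. A sequence is ascending if $x_n\le x_m$ whenever $n\le m$. $(X;\le;D)$ is complete if every ascending $D$-Cauchy sequence is $D$-convergent. The quasi-order $\le$ is $D$-self-closed if the $D$-limit of each ascending $D$-convergent sequence is an upper bound of that sequence. $(X;\le;D)$ is strongly complete if it is complete and $\le$ is $D$-self-closed. For $\varphi:X\to\mathbb{R}\cup\{\infty\}$, $\mathrm{Dom}(\varphi)=\{x\in X:\varphi(x)<\infty\}$. Subclasses of such functions: (P3) $\inf\varphi(X)>-\infty$; (P4) $\inf\varphi(X)\ge0$; (L1) (descending $(\le,D)$-lsc) if $(x_n)$ is ascending, $x_n\to_D x$, $x_n\le x$ for all $n$, and $(\varphi(x_n))$ is descending, then $\varphi(x_n)\ge\varphi(x)$ for all $n$; (L2) (descending $D$-lsc) if $x_n\to_D x$ and $(\varphi(x_n))$ is descending, then $\varphi(x_n)\ge\varphi(x)$ for all $n$; (L3) ($D$-lsc) if $x_n\to_D x$, then $\liminf_n\varphi(x_n)\ge\varphi(x)$.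 The result is understood in Zermelo-Fraenkel set theory without the Axiom of Choice, augmented by the Principle of Dependent Choices. *)

theory Defs
  imports Complex_Main "HOL-Library.Extended_Real"
begin

definition quasi_order_on :: "'a set \<Rightarrow> ('a \<Rightarrow> 'a \<Rightarrow> bool) \<Rightarrow> bool" where
  "quasi_order_on X le \<longleftrightarrow> reflp_on X le \<and> transp_on X le"

definition semimetric_on :: "'a set \<Rightarrow> ('a \<Rightarrow> 'a \<Rightarrow> real) \<Rightarrow> bool" where
  "semimetric_on X d \<longleftrightarrow>
     (\<forall>x\<in>X. \<forall>y\<in>X. 0 \<le> d x y) \<and>
     (\<forall>x\<in>X. d x x = 0) \<and>
     (\<forall>x\<in>X. \<forall>y\<in>X. d x y = d y x) \<and>
     (\<forall>x\<in>X. \<forall>y\<in>X. \<forall>z\<in>X. d x z \<le> d x y + d y z)"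

definition sufficient_on :: "'a set \<Rightarrow> (nat \<Rightarrow> 'a \<Rightarrow> 'a \<Rightarrow> real) \<Rightarrow> bool" where
  "sufficient_on X D \<longleftrightarrow> (\<forall>x\<in>X. \<forall>y\<in>X. (\<forall>i. D i x y = 0) \<longrightarrow> x = y)"

definition D_converges :: "(nat \<Rightarrow> 'a \<Rightarrow> 'a \<Rightarrow> real) \<Rightarrow> (nat \<Rightarrow> 'a) \<Rightarrow> 'a \<Rightarrow> bool" where
  "D_converges D s x \<longleftrightarrow> (\<forall>i. (\<lambda>n. D i (s n) x) \<longlonglongrightarrow> 0)"

definition D_Cauchy :: "(nat \<Rightarrow> 'a \<Rightarrow> 'a \<Rightarrow> real) \<Rightarrow> (nat \<Rightarrow> 'a) \<Rightarrow> bool" where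
  "D_Cauchy D s \<longleftrightarrow>
     (\<forall>i. \<forall>e>0. \<exists>N. \<forall>m\<ge>N. \<forall>n\<ge>N. \<bar>D i (s m) (s n)\<bar> < e)"

abbreviation ascending :: "('a \<Rightarrow> 'a \<Rightarrow> bool) \<Rightarrow> (nat \<Rightarrow> 'a) \<Rightarrow> bool" where
  "ascending le s \<equiv> monotone (\<le>) le s"

definition complete_on ::
  "'a set \<Rightarrow> ('a \<Rightarrow> 'a \<Rightarrow> bool) \<Rightarrow> (nat \<Rightarrow> 'a \<Rightarrow> 'a \<Rightarrow> real) \<Rightarrow> bool" where
  "complete_on X le D \<longleftrightarrow>
     (\<forall>s. range s \<subseteq> X \<and> ascending le s \<and> D_Cauchy D s \<longrightarrow> (\<exists>x\<in>X. D_converges D s x))"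

definition self_closed_on ::
  "'a set \<Rightarrow> ('a \<Rightarrow> 'a \<Rightarrow> bool) \<Rightarrow> (nat \<Rightarrow> 'a \<Rightarrow> 'a \<Rightarrow> real) \<Rightarrow> bool" where
  "self_closed_on X le D \<longleftrightarrow>
     (\<forall>s. \<forall>x\<in>X. range s \<subseteq> X \<and> ascending le s \<and> D_converges D s x \<longrightarrow> (\<forall>n. le (s n) x))"

definition strongly_complete_on ::
  "'a set \<Rightarrow> ('a \<Rightarrow> 'a \<Rightarrow> bool) \<Rightarrow> (nat \<Rightarrow> 'a \<Rightarrow> 'a \<Rightarrow> real) \<Rightarrow> bool" where
  "strongly_complete_on X le D \<longleftrightarrow> complete_on X le D \<and> self_closed_on X le D"

text \<open>Functions \<open>X \<rightarrow> \<real> \<union> {\<infinity>}\<close> are \<open>ereal\<close>-valued functions that avoid \<open>-\<infinity>\<close> on \<open>X\<close>.\<close>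

definition never_minus_infinity :: "'a set \<Rightarrow> ('a \<Rightarrow> ereal) \<Rightarrow> bool" where
  "never_minus_infinity X f \<longleftrightarrow> (\<forall>x\<in>X. f x \<noteq> -\<infinity>)"

definition Dom :: "'a set \<Rightarrow> ('a \<Rightarrow> ereal) \<Rightarrow> 'a set" where
  "Dom X f = {x \<in> X. f x < \<infinity>}"

definition Dom_family :: "'a set \<Rightarrow> (nat \<Rightarrow> 'a \<Rightarrow> ereal) \<Rightarrow> 'a set" where
  "Dom_family X F = (\<Inter>i. Dom X (F i))"

definition P3 :: "'a set \<Rightarrow> ('a \<Rightarrow> ereal) \<Rightarrow> bool" where
  "P3 X f \<longleftrightarrow> (INF x\<in>X. f x) > -\<infinity>"

definition P4 :: "'a set \<Rightarrow> ('a \<Rightarrow> ereal) \<Rightarrow> bool" where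
  "P4 X f \<longleftrightarrow> (INF x\<in>X. f x) \<ge> 0"

definition L1 ::
  "'a set \<Rightarrow> ('a \<Rightarrow> 'a \<Rightarrow> bool) \<Rightarrow> (nat \<Rightarrow> 'a \<Rightarrow> 'a \<Rightarrow> real) \<Rightarrow> ('a \<Rightarrow> ereal) \<Rightarrow> bool" where
  "L1 X le D f \<longleftrightarrow>
     (\<forall>s. \<forall>x\<in>X. range s \<subseteq> X \<and> ascending le s \<and> D_converges D s x \<and> (\<forall>n. le (s n) x)
        \<and> decseq (\<lambda>n. f (s n)) \<longrightarrow> (\<forall>n. f (s n) \<ge> f x))"

definition L2 ::
  "'a set \<Rightarrow> (nat \<Rightarrow> 'a \<Rightarrow> 'a \<Rightarrow> real) \<Rightarrow> ('a \<Rightarrow> ereal) \<Rightarrow> bool" where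
  "L2 X D f \<longleftrightarrow>
     (\<forall>s. \<forall>x\<in>X. range s \<subseteq> X \<and> D_converges D s x \<and> decseq (\<lambda>n. f (s n))
        \<longrightarrow> (\<forall>n. f (s n) \<ge> f x))"

definition L3 ::
  "'a set \<Rightarrow> (nat \<Rightarrow> 'a \<Rightarrow> 'a \<Rightarrow> real) \<Rightarrow> ('a \<Rightarrow> ereal) \<Rightarrow> bool" where
  "L3 X D f \<longleftrightarrow>
     (\<forall>s. \<forall>x\<in>X. range s \<subseteq> X \<and> D_converges D s x \<longrightarrow> liminf (\<lambda>n. f (s n)) \<ge> f x)"

end

theory Submission
  imports Defs "HOL-Library.Nat_Bijection"
begin

text \<open>
  The conclusion asks for a maximal point, above \<open>u\<close>, of the relation on \<open>Dom_family X \<Phi>\<close> that puts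
  \<open>y\<close> above \<open>x\<close> if \<open>le x y\<close> and moving from \<open>x\<close> to \<open>y\<close> costs, in every \<open>D i\<close>, at most the drop of
  \<open>\<Phi> i\<close> (\<open>ekeland_le\<close> below). A point \<open>x\<close> at which some \<open>\<Phi> i\<close> is infinite satisfies the last clause
  of the conclusion by itself, since then \<open>\<Phi> i v - \<Phi> i x = -\<infinity>\<close>.

  Each \<open>\<Phi> i\<close> decreases along this relation and is bounded below. Hence along an ascending sequence
  the values of each \<open>\<Phi> i\<close> converge, which makes the sequence \<open>D\<close>-Cauchy; completeness gives a limit,
  and self-closedness together with descending lower semicontinuity makes the limit an upper bound
  (\<open>ekeland_le_chain_bounded\<close>).

  The maximal point comes from a countable form of the Brezis-Browder principle
  (\<open>brezis_browder_countable\<close>): build an ascending sequence that nearly minimises one functional at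
  each step, and lets every functional have its turn infinitely often. No functional can then drop
  above an upper bound \<open>v\<close> of the sequence. So a point \<open>x\<close> above \<open>v\<close> has \<open>D i v x = 0\<close> for all \<open>i\<close>,
  and sufficiency yields \<open>x = v\<close>.
\<close>

section \<open>A Brezis-Browder principle for countably many functionals\<close>

text \<open>
  With a single functional one picks, at each step, a point above the current one that minimises the
  functional up to \<open>1 / (n + 1)\<close>. Countably many functionals cannot be nearly minimised at once, but
  step \<open>n\<close> may serve the functional with index \<open>fst (prod_decode n)\<close>, which takes each value for
  arbitrarily large \<open>n\<close>. The choices are made by dependent choice.
\<close>

lemma brezis_browder_countable:
  fixes \<psi> :: "nat \<Rightarrow> 'a \<Rightarrow> real"
  assumes quasi: "quasi_order_on S r"
    and antitone: "\<And>i x y. x \<in> S \<Longrightarrow> y \<in> S \<Longrightarrow> r x y \<Longrightarrow> \<psi> i y \<le> \<psi> i x"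
    and bounded: "\<And>i. bdd_below (\<psi> i ` S)"
    and chains: "\<And>s. range s \<subseteq> S \<Longrightarrow> ascending r s \<Longrightarrow> \<exists>b\<in>S. \<forall>n. r (s n) b"
    and u: "u \<in> S"
  shows "\<exists>v\<in>S. r u v \<and> (\<forall>w\<in>S. r v w \<longrightarrow> (\<forall>i. \<psi> i w = \<psi> i v))"
proof -
  have refl: "r x x" if "x \<in> S" for x
    using quasi that by (auto simp: quasi_order_on_def dest: reflp_onD)
  have trans: "r x z" if "r x y" "r y z" "x \<in> S" "y \<in> S" "z \<in> S" for x y z
    using quasi that by (auto simp: quasi_order_on_def dest: transp_onD)
  define near where "near n x y \<longleftrightarrow>
    r x y \<and> (\<forall>w\<in>S. r x w \<longrightarrow>
      \<psi> (fst (prod_decode n)) y \<le> \<psi> (fst (prod_decode n)) w + inverse (real (Suc n)))" for n x y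
  have step: "\<exists>y. y \<in> S \<and> near n x y" if x: "x \<in> S" for n x
  proof -
    define f where "f = \<psi> (fst (prod_decode n))"
    let ?A = "f ` {y \<in> S. r x y}"
    have ne: "?A \<noteq> {}"
      using refl x by blast
    have bd: "bdd_below ?A"
      by (rule bdd_below_mono[OF bounded[of "fst (prod_decode n)"]]) (auto simp: f_def)
    have "Inf ?A < Inf ?A + inverse (real (Suc n))"
      by simp
    then obtain y where y: "y \<in> S" "r x y" "f y < Inf ?A + inverse (real (Suc n))"
      using ne bd unfolding cInf_less_iff[OF ne bd] by blast
    have "f y \<le> f w + inverse (real (Suc n))" if "w \<in> S" "r x w" for w
    proof -
      have "Inf ?A \<le> f w"
        by (rule cInf_lower[OF _ bd]) (use that in blast)
      with y(3) show ?thesis by linarith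
    qed
    with y(1,2) show ?thesis
      by (auto simp: near_def f_def)
  qed
  have "\<exists>s. \<forall>n. (s n \<in> S \<and> (n = 0 \<longrightarrow> s n = u)) \<and> near n (s n) (s (Suc n))"
    by (rule dependent_nat_choice) (use u step in auto)
  then obtain s where s: "\<And>n. s n \<in> S" "s 0 = u" "\<And>n. near n (s n) (s (Suc n))"
    by blast
  have ascending: "ascending r s"
  proof (rule monotoneI)
    fix m n :: nat
    assume "m \<le> n"
    then show "r (s m) (s n)"
    proof (induction rule: dec_induct)
      case base
      show ?case by (rule refl[OF s(1)])
    next
      case (step k)
      then show ?case
        using trans s(1) s(3)[of k] unfolding near_def by blast
    qed
  qed
  obtain v where v: "v \<in> S" "\<And>n. r (s n) v"
    using chains[OF _ ascending] s(1) by blast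
  have "\<psi> i w = \<psi> i v" if w: "w \<in> S" "r v w" for w i
  proof (rule antisym)
    show "\<psi> i w \<le> \<psi> i v"
      using antitone w v(1) by blast
    show "\<psi> i v \<le> \<psi> i w"
    proof (rule field_le_epsilon)
      fix e :: real
      assume "0 < e"
      then obtain k where k: "inverse (real (Suc k)) < e"
        using reals_Archimedean by blast
      \<comment> \<open>A step, not earlier than step \<open>k\<close>, that serves the functional \<open>\<psi> i\<close>.\<close>
      define n where "n = prod_encode (i, k)"
      have "k \<le> n"
        unfolding n_def by (rule le_prod_encode_2)
      then have "inverse (real (Suc n)) \<le> inverse (real (Suc k))"
        by (simp add: le_imp_inverse_le)
      moreover have "\<psi> i (s (Suc n)) \<le> \<psi> i w + inverse (real (Suc n))"
        using s(3)[of n] w trans[OF v(2)[of n] w(2) s(1) v(1) w(1)]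
        by (simp add: near_def n_def)
      moreover have "\<psi> i v \<le> \<psi> i (s (Suc n))"
        using antitone s(1) v by blast
      ultimately show "\<psi> i v \<le> \<psi> i w + e"
        using k by linarith
    qed
  qed
  then show ?thesis
    using v s(2) by metis
qed

section \<open>The order induced by semimetrics and functions\<close>

definition ekeland_le ::
  "('a \<Rightarrow> 'a \<Rightarrow> bool) \<Rightarrow> (nat \<Rightarrow> 'a \<Rightarrow> 'a \<Rightarrow> real) \<Rightarrow> (nat \<Rightarrow> 'a \<Rightarrow> real) \<Rightarrow> 'a \<Rightarrow> 'a \<Rightarrow> bool" where
  "ekeland_le le D g x y \<longleftrightarrow> le x y \<and> (\<forall>i. D i x y \<le> g i x - g i y)"

lemma quasi_order_on_ekeland_le:
  assumes "quasi_order_on X le" and "\<And>i. semimetric_on X (D i)" and "Y \<subseteq> X"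
  shows "quasi_order_on Y (ekeland_le le D g)"
  unfolding quasi_order_on_def
proof
  show "reflp_on Y (ekeland_le le D g)"
    using assms
    by (auto intro!: reflp_onI simp: ekeland_le_def quasi_order_on_def semimetric_on_def subset_iff
        dest: reflp_onD)
  show "transp_on Y (ekeland_le le D g)"
  proof (rule transp_onI)
    fix x y z
    assume mem: "x \<in> Y" "y \<in> Y" "z \<in> Y"
      and le: "ekeland_le le D g x y" "ekeland_le le D g y z"
    have "le x z"
      using assms mem le by (auto simp: ekeland_le_def quasi_order_on_def dest: transp_onD)
    moreover have "D i x z \<le> g i x - g i z" for i
    proof -
      have "D i x z \<le> D i x y + D i y z"
        using assms(2)[of i] assms(3) mem unfolding semimetric_on_def by blast
      also have "\<dots> \<le> (g i x - g i y) + (g i y - g i z)"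
        using le by (intro add_mono) (auto simp: ekeland_le_def)
      finally show ?thesis by simp
    qed
    ultimately show "ekeland_le le D g x z"
      by (simp add: ekeland_le_def)
  qed
qed

text \<open>
  On an ascending sequence of this relation the distances are controlled by the differences of a
  convergent sequence of reals, so it is \<open>D\<close>-Cauchy.
\<close>

lemma D_Cauchy_if_ascending_ekeland_le:
  assumes "\<And>i. semimetric_on X (D i)" and "range s \<subseteq> X"
    and asc: "ascending (ekeland_le le D g) s"
    and bounded: "\<And>i. bdd_below (range (\<lambda>n. g i (s n)))"
  shows "D_Cauchy D s"
  unfolding D_Cauchy_def
proof (intro allI impI)
  fix i and e :: real
  assume "0 < e"
  have in_X: "s n \<in> X" for n
    using assms(2) by blast
  have nonneg: "0 \<le> D i (s m) (s n)" and sym: "D i (s m) (s n) = D i (s n) (s m)" for m n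
    using assms(1)[of i] in_X by (auto simp: semimetric_on_def)
  have le: "D i (s m) (s n) \<le> g i (s m) - g i (s n)" if "m \<le> n" for m n
    using monotoneD[OF asc that] by (simp add: ekeland_le_def)
  have dist_le: "D i (s m) (s n) \<le> \<bar>g i (s m) - g i (s n)\<bar>" for m n
  proof (cases "m \<le> n")
    case True
    then show ?thesis using le[of m n] by linarith
  next
    case False
    then show ?thesis using le[of n m] sym[of m n] by linarith
  qed
  have "decseq (\<lambda>n. g i (s n))"
  proof (rule decseq_SucI)
    fix n
    show "g i (s (Suc n)) \<le> g i (s n)"
      using le[of n "Suc n"] nonneg[of n "Suc n"] by simp
  qed
  then have "(\<lambda>n. g i (s n)) \<longlonglongrightarrow> (INF n. g i (s n))"
    by (rule LIMSEQ_decseq_INF[OF bounded])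
  then have "Cauchy (\<lambda>n. g i (s n))"
    by (rule LIMSEQ_imp_Cauchy)
  then obtain N where "\<forall>m\<ge>N. \<forall>n\<ge>N. dist (g i (s m)) (g i (s n)) < e"
    using \<open>0 < e\<close> unfolding Cauchy_def by blast
  then show "\<exists>N. \<forall>m\<ge>N. \<forall>n\<ge>N. \<bar>D i (s m) (s n)\<bar> < e"
    using dist_le nonneg by (metis abs_of_nonneg dist_real_def le_less_trans)
qed

text \<open>
  Lower semicontinuity gives \<open>\<Phi> i x \<le> \<Phi> i (s n)\<close> at the limit \<open>x\<close>; this keeps \<open>x\<close> in the common
  domain and lets the estimates \<open>D i (s n) (s m) \<le> \<Phi> i (s n) - \<Phi> i (s m)\<close> pass to the limit in \<open>m\<close>.
\<close>

lemma ekeland_le_chain_bounded: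
  fixes \<Phi> :: "nat \<Rightarrow> 'a \<Rightarrow> ereal"
  defines "g \<equiv> \<lambda>i x. real_of_ereal (\<Phi> i x)"
  assumes semi: "\<And>i. semimetric_on X (D i)"
    and complete: "strongly_complete_on X le D"
    and finite: "\<And>i x. x \<in> Dom_family X \<Phi> \<Longrightarrow> \<Phi> i x = ereal (g i x)"
    and bounded: "\<And>i. bdd_below (g i ` Dom_family X \<Phi>)"
    and lsc: "\<And>i. L1 X le D (\<Phi> i)"
    and s: "range s \<subseteq> Dom_family X \<Phi>" "ascending (ekeland_le le D g) s"
  shows "\<exists>x\<in>Dom_family X \<Phi>. \<forall>n. ekeland_le le D g (s n) x"
proof -
  have in_dom: "s n \<in> Dom_family X \<Phi>" for n
    using s(1) by blast
  then have in_X: "s n \<in> X" for n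
    by (auto simp: Dom_family_def Dom_def)
  have asc: "ascending le s"
    using s(2) by (auto simp: monotone_def monotone_on_def ekeland_le_def)
  have "D_Cauchy D s"
  proof (rule D_Cauchy_if_ascending_ekeland_le[OF semi _ s(2)])
    show "bdd_below (range (\<lambda>n. g i (s n)))" for i
      by (rule bdd_below_mono[OF bounded[of i]]) (use in_dom in blast)
  qed (use in_X in blast)
  then obtain x where x: "x \<in> X" "D_converges D s x"
    using complete asc in_X unfolding strongly_complete_on_def complete_on_def by blast
  have le_x: "le (s n) x" for n
    using complete x asc in_X unfolding strongly_complete_on_def self_closed_on_def by blast
  have drop: "D i (s n) (s m) \<le> g i (s n) - g i (s m)" if "n \<le> m" for i n m
    using monotoneD[OF s(2) that] by (simp add: ekeland_le_def)
  have \<Phi>_le: "\<Phi> i x \<le> \<Phi> i (s n)" for i n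
  proof -
    have "decseq (\<lambda>n. \<Phi> i (s n))"
    proof (rule decseq_SucI)
      fix n
      have "0 \<le> D i (s n) (s (Suc n))"
        using semi[of i] in_X by (auto simp: semimetric_on_def)
      then show "\<Phi> i (s (Suc n)) \<le> \<Phi> i (s n)"
        using drop[of n "Suc n" i] by (simp add: finite[OF in_dom])
    qed
    then show ?thesis
      using lsc[of i] x asc le_x in_X unfolding L1_def by blast
  qed
  have "\<Phi> i x < \<infinity>" for i
    using \<Phi>_le[of i 0] finite[OF in_dom, of i 0] by (cases "\<Phi> i x") auto
  then have x_dom: "x \<in> Dom_family X \<Phi>"
    using x(1) by (simp add: Dom_family_def Dom_def)
  have g_le: "g i x \<le> g i (s n)" for i n
    using \<Phi>_le[of i n] by (simp add: finite[OF in_dom] finite[OF x_dom])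
  have "D i (s n) x \<le> g i (s n) - g i x" for i n
  proof (rule LIMSEQ_le_const)
    have "(\<lambda>m. D i (s m) x) \<longlonglongrightarrow> 0"
      using x(2) by (simp add: D_converges_def)
    from tendsto_add[OF tendsto_const this]
    show "(\<lambda>m. (g i (s n) - g i x) + D i (s m) x) \<longlonglongrightarrow> g i (s n) - g i x"
      by simp
    show "\<exists>N. \<forall>m\<ge>N. D i (s n) x \<le> (g i (s n) - g i x) + D i (s m) x"
    proof (intro exI allI impI)
      fix m
      assume "n \<le> m"
      have "D i (s n) x \<le> D i (s n) (s m) + D i (s m) x"
        using semi[of i] in_X x(1) unfolding semimetric_on_def by blast
      with drop[OF \<open>n \<le> m\<close>, of i] g_le[of i m]
      show "D i (s n) x \<le> (g i (s n) - g i x) + D i (s m) x" by linarith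
    qed
  qed
  with x_dom le_x show ?thesis
    by (auto simp: ekeland_le_def)
qed

section \<open>Semicontinuity and boundedness classes\<close>

text \<open>Along a descending sequence of values the limit inferior is the infimum.\<close>

lemma L3_imp_L2:
  assumes "L3 X D f"
  shows "L2 X D f"
  unfolding L2_def
proof (intro allI ballI impI, elim conjE)
  fix s x n
  assume "x \<in> X" "range s \<subseteq> X" "D_converges D s x" and dec: "decseq (\<lambda>n. f (s n))"
  then have "f x \<le> liminf (\<lambda>n. f (s n))"
    using assms unfolding L3_def by blast
  also have "\<dots> = (INF n. f (s n))"
    using LIMSEQ_INF[OF dec] by (intro lim_imp_Liminf) auto
  also have "\<dots> \<le> f (s n)"
    by (rule INF_lower) simp
  finally show "f x \<le> f (s n)" .
qed

lemma L2_imp_L1: "L2 X D f \<Longrightarrow> L1 X le D f"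
  unfolding L1_def L2_def by blast

lemma P4_imp_P3: "P4 X f \<Longrightarrow> P3 X f"
  unfolding P3_def P4_def by (rule less_le_trans[of _ 0]) auto

lemma bdd_below_real_of_ereal_Dom_family:
  assumes "P3 X (\<Phi> i)" and "\<And>x. x \<in> Dom_family X \<Phi> \<Longrightarrow> \<bar>\<Phi> i x\<bar> \<noteq> \<infinity>"
  shows "bdd_below ((\<lambda>x. real_of_ereal (\<Phi> i x)) ` Dom_family X \<Phi>)"
proof -
  obtain c where c: "ereal c < (INF x\<in>X. \<Phi> i x)"
    using assms(1) ereal_dense2 unfolding P3_def by blast
  have "c \<le> real_of_ereal (\<Phi> i x)" if x: "x \<in> Dom_family X \<Phi>" for x
  proof -
    have "x \<in> X"
      using x by (auto simp: Dom_family_def Dom_def)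
    then have "ereal c \<le> \<Phi> i x"
      using c by (meson INF_lower less_imp_le order_trans)
    also have "\<dots> = ereal (real_of_ereal (\<Phi> i x))"
      using assms(2)[OF x] by (simp add: ereal_real)
    finally show ?thesis by simp
  qed
  then show ?thesis by (intro bdd_belowI2)
qed

section \<open>The variational principle\<close>

theorem theorem4:
  fixes X :: "'a set"
    and le :: "'a \<Rightarrow> 'a \<Rightarrow> bool"
    and D :: "nat \<Rightarrow> 'a \<Rightarrow> 'a \<Rightarrow> real"
    and \<Phi> :: "nat \<Rightarrow> 'a \<Rightarrow> ereal"
  assumes "quasi_order_on X le"
    and "\<And>i. semimetric_on X (D i)"
    and "sufficient_on X D"
    and "strongly_complete_on X le D"
    and "\<And>i. never_minus_infinity X (\<Phi> i)"
    and "Dom_family X \<Phi> \<noteq> {}"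
    and "(\<forall>i. P3 X (\<Phi> i)) \<or> (\<forall>i. P4 X (\<Phi> i))"
    and "(\<forall>i. L1 X le D (\<Phi> i)) \<or> (\<forall>i. L2 X D (\<Phi> i)) \<or> (\<forall>i. L3 X D (\<Phi> i))"
  shows "\<forall>u \<in> Dom_family X \<Phi>. \<exists>v \<in> Dom_family X \<Phi>.
           le u v \<and> (\<forall>i. ereal (D i u v) \<le> \<Phi> i u - \<Phi> i v) \<and>
           (\<forall>x\<in>X. le v x \<and> x \<noteq> v \<longrightarrow> (\<exists>i. ereal (D i v x) > \<Phi> i v - \<Phi> i x))"
proof
  fix u
  assume u: "u \<in> Dom_family X \<Phi>"
  let ?Y = "Dom_family X \<Phi>"
  define g where "g = (\<lambda>i x. real_of_ereal (\<Phi> i x))"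
  have Y_X: "?Y \<subseteq> X"
    by (auto simp: Dom_family_def Dom_def)
  have not_inf: "\<bar>\<Phi> i x\<bar> \<noteq> \<infinity>" if "x \<in> ?Y" for i x
    using assms(5)[of i] that by (auto simp: never_minus_infinity_def Dom_family_def Dom_def)
  then have finite: "\<Phi> i x = ereal (g i x)" if "x \<in> ?Y" for i x
    using that by (simp add: g_def ereal_real)
  have P3: "P3 X (\<Phi> i)" for i
    using assms(7) P4_imp_P3 by blast
  have L1: "L1 X le D (\<Phi> i)" for i
    using assms(8) L2_imp_L1 L3_imp_L2 by metis
  have bounded: "bdd_below (g i ` ?Y)" for i
    unfolding g_def by (rule bdd_below_real_of_ereal_Dom_family[OF P3 not_inf])
  have nonneg: "0 \<le> D i x y" if "x \<in> X" "y \<in> X" for i x y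
    using assms(2)[of i] that by (simp add: semimetric_on_def)
  have "\<exists>v\<in>?Y. ekeland_le le D g u v \<and>
      (\<forall>w\<in>?Y. ekeland_le le D g v w \<longrightarrow> (\<forall>i. g i w = g i v))"
  proof (rule brezis_browder_countable)
    show "quasi_order_on ?Y (ekeland_le le D g)"
      by (rule quasi_order_on_ekeland_le[OF assms(1,2) Y_X])
    show "g i y \<le> g i x" if "x \<in> ?Y" "y \<in> ?Y" "ekeland_le le D g x y" for i x y
    proof -
      have "D i x y \<le> g i x - g i y"
        using that(3) by (simp add: ekeland_le_def)
      moreover have "0 \<le> D i x y"
        using nonneg that(1,2) Y_X by blast
      ultimately show ?thesis by linarith
    qed
    show "\<exists>b\<in>?Y. \<forall>n. ekeland_le le D g (s n) b"
      if "range s \<subseteq> ?Y" "ascending (ekeland_le le D g) s" for s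
      using ekeland_le_chain_bounded[of X D le \<Phi> s] assms(2,4) finite bounded L1 that
      unfolding g_def by blast
  qed (use bounded u in auto)
  then obtain v where v: "v \<in> ?Y" "ekeland_le le D g u v"
    and const: "\<And>w i. w \<in> ?Y \<Longrightarrow> ekeland_le le D g v w \<Longrightarrow> g i w = g i v"
    by blast
  have "\<exists>i. ereal (D i v x) > \<Phi> i v - \<Phi> i x" if x: "x \<in> X" "le v x" "x \<noteq> v" for x
  proof (rule ccontr)
    assume "\<not> ?thesis"
    then have small: "ereal (D i v x) \<le> \<Phi> i v - \<Phi> i x" for i
      by (simp add: not_less)
    have "\<Phi> i x < \<infinity>" for i
      using small[of i] finite[OF v(1), of i] by (cases "\<Phi> i x") auto
    then have x_Y: "x \<in> ?Y"
      using x(1) by (simp add: Dom_family_def Dom_def)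
    have le: "D i v x \<le> g i v - g i x" for i
      using small[of i] by (simp add: finite[OF v(1)] finite[OF x_Y])
    have "g i x = g i v" for i
      by (rule const[OF x_Y]) (simp add: ekeland_le_def x(2) le)
    then have "D i v x = 0" for i
      using le[of i] nonneg[of v x i] v(1) x(1) Y_X by auto
    then have "v = x"
      using assms(3) v(1) x(1) Y_X unfolding sufficient_on_def by blast
    with x(3) show False by simp
  qed
  moreover have "le u v \<and> (\<forall>i. ereal (D i u v) \<le> \<Phi> i u - \<Phi> i v)"
    using v(2) by (simp add: ekeland_le_def finite[OF u] finite[OF v(1)])
  ultimately show "\<exists>v\<in>?Y. le u v \<and> (\<forall>i. ereal (D i u v) \<le> \<Phi> i u - \<Phi> i v) \<and>
      (\<forall>x\<in>X. le v x \<and> x \<noteq> v \<longrightarrow> (\<exists>i. ereal (D i v x) > \<Phi> i v - \<Phi> i x))"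
    using v(1) by blast
qed

end
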